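(* The lower $C$-distribution function $F_{X,C}\colon\mathbb{R}^d\to[0,1]$ and the capacity functional $T_{\mathcal{X}}\colon\mathcal{K}\to[0,1]$ of the set-valued random variable $\mathcal{X}=Q^-_{X,C}(U)$ determine each other. That is, for any $X_1,X_2\in L^0_d$, with associated random sets $\mathcal{X}_i(\omega)=Q^-_{X_i,C}(U(\omega))$, $i=1,2$, one has $$F_{X_1,C}=F_{X_2,C}\ \text{ on }\mathbb{R}^d\quad\Longleftrightarrow\quad T_{\mathcal{X}_1}=T_{\mathcal{X}_2}\ \text{ on }\mathcal{K}.$$
   Context: Let $d\ge1$, let $(\Omega,\mathcal{A},\mathbb{P})$ be a probability space and let $L^0_d$ be the space of (equivalence classes of) random variables with values in $\mathbb{R}^d$. Let $C$ be a nonempty closed convex cone with $C\subsetneq\mathbb{R}^d$ (neither nonempty interior nor pointedness is assumed). Its dual cone is $C^+=\{w\in\mathbb{R}^d\mid w^Tz\ge0\text{ for all }z\in C\}$. For $X\in L^0_d$, $w\in\mathbb{R}^d\setminus\{0\}$, $z\in\mathbb{R}^d$: $F_{X,w}(z)=\mathbb{P}\{w^TX\le w^Tz\}$, and the lower $C$-distribution function is $F_{X,C}(z)=\inf_{w\in C^+\setminus\{0\}}F_{X,w}(z)$. For $p\in[0,1]$ the lower $C$-quantile is $Q^-_{X,C}(p)=\{z\in\mathbb{R}^d\mid F_{X,C}(z)\ge p\}$, which is an element of $\mathcal{G}(\mathbb{R}^d,C)=\{D\subseteq\mathbb{R}^d\mid D=\mathrm{cl}\,\mathrm{co}(D+C)\}$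 (closed convex hull of the Minkowski sum, with $\emptyset+C=\emptyset$). Let $U\colon\Omega\to[0,1]$ be a random variable uniformly distributed on $[0,1]$, and define $\mathcal{X}\colon\Omega\to\mathcal{G}(\mathbb{R}^d,C)$ by $\mathcal{X}(\omega)=Q^-_{X,C}(U(\omega))$. Let $\mathcal{K}$ be the set of all compact subsets of $\mathbb{R}^d$. The function $\mathcal{X}$ is measurable with respect to the $\sigma$-algebra on $\mathcal{G}(\mathbb{R}^d,C)$ generated by the sets $\{D\in\mathcal{G}(\mathbb{R}^d,C)\mid D\cap K\ne\emptyset\}$, $K\in\mathcal{K}$. The capacity functional of $\mathcal{X}$ is $T_{\mathcal{X}}(K)=\mathbb{P}\{\mathcal{X}\cap K\neq\emptyset\}$ for $K\in\mathcal{K}$. *)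

theory Defs
  imports "HOL-Probability.Probability"
begin

definition dual_cone :: "'a::real_inner set \<Rightarrow> 'a set" where
  "dual_cone C = {w. \<forall>z\<in>C. 0 \<le> w \<bullet> z}"

definition scalar_cdf :: "'w measure \<Rightarrow> ('w \<Rightarrow> 'a::real_inner) \<Rightarrow> 'a \<Rightarrow> 'a \<Rightarrow> real" where
  "scalar_cdf M X w z = measure M {\<omega> \<in> space M. w \<bullet> X \<omega> \<le> w \<bullet> z}"

text \<open>
  The infimum is taken in the conditionally complete order on \<^typ>\<open>real\<close>. Its index set is nonempty
  whenever \<open>C\<close> is a closed convex cone different from the whole space, and it is bounded below by 0.
\<close>
definition lower_cdf :: "'w measure \<Rightarrow> 'a::real_inner set \<Rightarrow> ('w \<Rightarrow> 'a) \<Rightarrow> 'a \<Rightarrow> real" where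
  "lower_cdf M C X z = (INF w \<in> dual_cone C - {0}. scalar_cdf M X w z)"

definition lower_quantile :: "'w measure \<Rightarrow> 'a::real_inner set \<Rightarrow> ('w \<Rightarrow> 'a) \<Rightarrow> real \<Rightarrow> 'a set" where
  "lower_quantile M C X p = {z. p \<le> lower_cdf M C X z}"

definition quantile_random_set ::
    "'w measure \<Rightarrow> 'a::real_inner set \<Rightarrow> ('w \<Rightarrow> 'a) \<Rightarrow> ('w \<Rightarrow> real) \<Rightarrow> 'w \<Rightarrow> 'a set" where
  "quantile_random_set M C X U \<omega> = lower_quantile M C X (U \<omega>)"

definition capacity_functional :: "'w measure \<Rightarrow> ('w \<Rightarrow> 'a set) \<Rightarrow> 'a set \<Rightarrow> real" where
  "capacity_functional M \<X> K = measure M {\<omega> \<in> space M. \<X> \<omega> \<inter> K \<noteq> {}}"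

end

theory Submission
  imports Defs
begin

text \<open>
  The random set at level \<open>U\<close> depends on \<open>X\<close> only through the lower \<open>C\<close>-distribution function, so
  equal distribution functions give the same random set at every \<open>\<omega>\<close>, hence equal capacities.

  Conversely, singletons are compact and already carry all the information: \<open>z\<close> lies in the
  quantile at level \<open>U \<omega>\<close> exactly when \<open>U \<omega>\<close> is at most the value \<open>F z\<close> of the distribution function.
  As \<open>U\<close> is uniform on \<open>[0,1]\<close>, this event has probability \<open>F z\<close>, provided \<open>F z\<close> lies in \<open>[0,1]\<close>;
  so the capacity of \<open>{z}\<close> recovers \<open>F z\<close>. The proviso is where the geometry of \<open>C\<close> enters: an
  infimum of probabilities lies in \<open>[0,1]\<close> if its index set is nonempty, and separating \<open>C\<close> from a
  point outside it produces a nonzero element of the dual cone.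
\<close>

text \<open>
  A functional bounded below on a cone is nonnegative there, because positive
  multiples of a negative value reach every negative level. Hence the normal of a hyperplane that strictly separates \<open>C\<close> from an
  outside point belongs to the dual cone.
\<close>
lemma dual_cone_nontrivial:
  fixes C :: "'a::euclidean_space set"
  assumes "C \<noteq> {}" "closed C" "convex C" "cone C" "C \<noteq> UNIV"
  shows "dual_cone C - {0} \<noteq> {}"
proof -
  obtain x where "x \<notin> C"
    using assms(5) by auto
  then obtain a b where ab: "a \<bullet> x < b" "\<And>y. y \<in> C \<Longrightarrow> b < a \<bullet> y"
    using separating_hyperplane_closed_point[OF assms(3,2)] by blast
  have "0 \<in> C"
    using assms(1,4) cone_contains_0 by blast
  then have "b < 0"
    using ab(2)[of 0] by simp
  then have "a \<noteq> 0"
    using ab(1) by auto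
  moreover have "0 \<le> a \<bullet> y" if "y \<in> C" for y
  proof (rule ccontr)
    assume neg: "\<not> 0 \<le> a \<bullet> y"
    \<comment> \<open>This multiple of \<open>y\<close> lies on the separating hyperplane itself.\<close>
    have "(b / (a \<bullet> y)) *\<^sub>R y \<in> C"
      using assms(4) that neg \<open>b < 0\<close> by (intro mem_cone) (auto intro: divide_nonpos_nonpos)
    then have "b < a \<bullet> ((b / (a \<bullet> y)) *\<^sub>R y)"
      by (rule ab(2))
    then show False
      using neg by simp
  qed
  ultimately show ?thesis
    by (auto simp: dual_cone_def)
qed

lemma (in prob_space) lower_cdf_bounds:
  fixes C :: "'b::real_inner set"
  assumes "dual_cone C - {0} \<noteq> {}"
  shows "lower_cdf M C X z \<in> {0..1}"
proof -
  have scalar: "0 \<le> scalar_cdf M X w z" "scalar_cdf M X w z \<le> 1" for w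
    by (simp_all add: scalar_cdf_def)
  obtain w where w: "w \<in> dual_cone C - {0}"
    using assms by blast
  have "lower_cdf M C X z \<le> 1"
    unfolding lower_cdf_def
    by (rule cINF_lower2[OF _ w scalar(2)]) (auto intro!: bdd_belowI2 scalar(1))
  moreover have "0 \<le> lower_cdf M C X z"
    unfolding lower_cdf_def using assms scalar(1) by (intro cINF_greatest)
  ultimately show ?thesis
    by simp
qed

lemma uniform_01_cdf:
  fixes U :: "'w \<Rightarrow> real"
  assumes "U \<in> borel_measurable M"
    and "distr M lborel U = uniform_measure lborel {0..1}"
    and "p \<in> {0..1}"
  shows "measure M {\<omega> \<in> space M. U \<omega> \<le> p} = p"
proof -
  have "measure M {\<omega> \<in> space M. U \<omega> \<le> p} = measure (distr M lborel U) {..p}"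
    using assms(1) by (subst measure_distr) (auto intro!: arg_cong[where f = "measure M"])
  also have "\<dots> = measure lborel ({0..1} \<inter> {..p}) / measure lborel {0..1::real}"
    unfolding assms(2) by (subst measure_uniform_measure) auto
  also have "{0..1} \<inter> {..p} = {0..p}"
    using assms(3) by auto
  finally show ?thesis
    using assms(3) by simp
qed

text \<open>
  The capacity of a point is the distribution function at that point: this is the inversion that
  makes the capacity functional determine the distribution function.
\<close>
lemma (in prob_space) capacity_functional_singleton:
  fixes C :: "'b::real_inner set"
  assumes "dual_cone C - {0} \<noteq> {}"
    and "U \<in> borel_measurable M"
    and "distr M lborel U = uniform_measure lborel {0..1}"
  shows "capacity_functional M (quantile_random_set M C X U) {z} = lower_cdf M C X z"
proof -
  have "capacity_functional M (quantile_random_set M C X U) {z} =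
      measure M {\<omega> \<in> space M. U \<omega> \<le> lower_cdf M C X z}"
    by (simp add: capacity_functional_def quantile_random_set_def lower_quantile_def)
  also have "\<dots> = lower_cdf M C X z"
    using assms lower_cdf_bounds by (intro uniform_01_cdf)
  finally show ?thesis .
qed

theorem proposition6:
  fixes M :: "'w measure"
    and C :: "(real ^ 'd) set"
    and U :: "'w \<Rightarrow> real"
    and X1 X2 :: "'w \<Rightarrow> real ^ 'd"
  assumes "prob_space M"
    and "C \<noteq> {}" and "closed C" and "convex C" and "cone C" and "C \<subset> UNIV"
    and "U \<in> borel_measurable M"
    and "\<And>\<omega>. \<omega> \<in> space M \<Longrightarrow> U \<omega> \<in> {0..1}"
    and "distr M lborel U = uniform_measure lborel {0..1}"
    and "X1 \<in> borel_measurable M" and "X2 \<in> borel_measurable M"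
  shows "(\<forall>z. lower_cdf M C X1 z = lower_cdf M C X2 z) \<longleftrightarrow>
    (\<forall>K. compact K \<longrightarrow>
      capacity_functional M (quantile_random_set M C X1 U) K =
      capacity_functional M (quantile_random_set M C X2 U) K)"
    (is "?cdfs \<longleftrightarrow> ?capacities")
proof
  assume ?cdfs
  then show ?capacities
    by (simp add: capacity_functional_def quantile_random_set_def lower_quantile_def)
next
  assume capacities: ?capacities
  interpret prob_space M by fact
  have "dual_cone C - {0} \<noteq> {}"
    using assms(2-6) by (intro dual_cone_nontrivial) auto
  note inversion = capacity_functional_singleton[OF this assms(7,9)]
  show ?cdfs
  proof
    fix z
    show "lower_cdf M C X1 z = lower_cdf M C X2 z"
      using capacities[rule_format, of "{z}"] by (simp add: inversion)
  qed
qed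

end
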